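(* Let $\mathcal B=\mathcal B_1,\mathcal B_2,\ldots$ be the sequence of even binary partitions defined in the context. Let $P$ be a term of $\mathcal B$, and for $k\ge1$ let $d_k$ be the number of parts of $P$ equal to $2^k$. Let $i$ be the largest $k\ge1$ with $d_k>0$ ($i=0$ if $P=\emptyset$); let $j$ be the largest $k$ with $1\le k<i$ and $d_k>0$ ($j=0$ if there is none); let $\epsilon=(-1)^{d_1+d_2+\cdots+d_{i-1}}$. The digit $d_0$ is not a part count of $P$: it stands for an unlimited supply of parts equal to $1$ and is regarded as an even integer $\ge 2$ (in particular, when $j=0$ the condition $d_j=1$ fails). Define the following six operations on the digit vector $(d_k)_{k\ge0}$, after which all parts equal to $1$ are discarded (so a change of $d_0$ has no effect on the resulting partition): (a) if $d_i=1$ and $\epsilon=-\sigma$: decrease $d_i$ by $1$ and increase $d_{i-1}$ by $2$ (split a largest part); (b) if $d_i$ is odd, $d_i\neq 1$, and $\epsilon=-\sigma$: increase $d_{i+1}$ by $1$ and decrease $d_i$ by $2$ (merge two largest parts); (c) if $d_i$ is odd, $d_j=1$, and $\epsilon=\sigma$: decrease $d_j$ by $1$ and increase $d_{j-1}$ by $2$ (split a second-largest part); (d) if $d_i$ is odd, $d_j\neq1$, and $\epsilon=\sigma$: increase $d_{j+1}$ by $1$ and decrease $d_j$ by $2$ (merge two second-largest parts); (e) if $d_i$ is even and $\epsilon=-\sigma$: decrease $d_i$ by $1$ and increase $d_{i-1}$ by $2$ (split a largest part); (f) if $d_i$ is even and $\epsilon=\sigma$: increase $d_{i+1}$ by $1$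 and decrease $d_i$ by $2$ (merge two largest parts). Then: taking $\sigma=+1$, the applicable operation transforms $P$ into its successor in $\mathcal B$; and if $P\neq\mathcal B_1$, taking $\sigma=-1$, the applicable operation transforms $P$ into its predecessor in $\mathcal B$.
   Context: A binary partition of $n\ge0$ is a multiset of powers of two ($1,2,4,\dots$) summing to $n$; $\emptyset$ is the unique binary partition of $0$. Let $b(n)$ be the number of binary partitions of $n$. For a partition $P$, $P+1$ denotes $P$ with an extra part $1$ added, and $2\times P$ denotes $P$ with every part doubled. Define ordered lists $\mathcal B(n)$ of all binary partitions of $n$ recursively: $\mathcal B(0)=(\emptyset)$; for $n\ge1$: - if $n$ is odd, $\mathcal B(n)$ is the list $(Q+1)$ for $Q$ running through $\mathcal B(n-1)$ in order; - if $n\equiv0\pmod 4$, $\mathcal B(n)$ is the list $(Q+1)$ for $Q$ running through $\mathcal B(n-1)$ in order, followed by $(2\times Q)$ for $Q$ running through $\mathcal B(n/2)$ in order; - if $n\equiv2\pmod 4$, $\mathcal B(n)$ is the list $(Q+1)$ for $Q$ running through $\mathcal B(n-1)$ in order, followed by $(2\times Q)$ for $Q$ running through $\mathcal B(n/2)$ in reverse order. An even binary partition is a binary partition with no part equal to $1$. The infinite sequence $\mathcal B=\mathcal B_1,\mathcal B_2,\dots$ is the concatenation, over $n=0,2,4,6,\dots$ in increasing order, of the blocks: for $n=0$ the single term $\emptyset$; for even $n\ge2$ the terms of $\mathcal B(n)$ having no part equal to $1$ (these are its last $b(n/2)$ terms), in the order they occur in $\mathcal B(n)$. Thus $\mathcal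 B_1=\emptyset$ and $\mathcal B$ lists every even binary partition exactly once. *)

theory Defs
  imports "HOL-Library.Multiset" "HOL-Library.Stream"
begin

definition binary_partition :: "nat \<Rightarrow> nat multiset \<Rightarrow> bool" where
  "binary_partition n P \<longleftrightarrow> (\<forall>x\<in>#P. \<exists>k. x = 2 ^ k) \<and> sum_mset P = n"

definition plus_one :: "nat multiset \<Rightarrow> nat multiset" where
  "plus_one P = add_mset 1 P"

definition double :: "nat multiset \<Rightarrow> nat multiset" where
  "double P = image_mset (\<lambda>x. 2 * x) P"

fun bp_list :: "nat \<Rightarrow> nat multiset list" where
  "bp_list n =
    (if n = 0 then [{#}]
     else if odd n then map plus_one (bp_list (n - 1))
     else if n mod 4 = 0 then
       map plus_one (bp_list (n - 1)) @ map double (bp_list (n div 2))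
     else
       map plus_one (bp_list (n - 1)) @ map double (rev (bp_list (n div 2))))"

declare bp_list.simps [simp del]

definition even_block :: "nat \<Rightarrow> nat multiset list" where
  "even_block n = filter (\<lambda>P. 1 \<notin># P) (bp_list n)"

text \<open>Streams are indexed from 0, so the first term \<open>\<B>\<^sub>1\<close> of the sequence is
  \<open>even_bps !! 0\<close>. The function \<^const>\<open>flat\<close> is only meaningful on a stream of nonempty
  lists; this is lemma \<open>even_block_nonempty\<close> below.\<close>

definition even_bps :: "nat multiset stream" where
  "even_bps = flat (smap (\<lambda>m. even_block (2 * m)) nats)"

text \<open>\<open>d 0\<close> may be any even number that is at least 2.\<close>

definition digits_of :: "nat multiset \<Rightarrow> (nat \<Rightarrow> nat) \<Rightarrow> bool" where
  "digits_of P d \<longleftrightarrow> (\<forall>k\<ge>1. d k = count P (2 ^ k)) \<and> even (d 0) \<and> d 0 \<ge> 2"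

definition partition_of :: "(nat \<Rightarrow> nat) \<Rightarrow> nat multiset" where
  "partition_of d = filter_mset (\<lambda>x. x \<noteq> 1) (\<Sum>k | d k > 0. replicate_mset (d k) (2 ^ k))"

definition top_index :: "(nat \<Rightarrow> nat) \<Rightarrow> nat" where
  "top_index d =
    (if \<exists>k\<ge>1. d k > 0 then Max {k. 1 \<le> k \<and> d k > 0} else 0)"

definition second_index :: "(nat \<Rightarrow> nat) \<Rightarrow> nat" where
  "second_index d =
    (if \<exists>k\<ge>1. k < top_index d \<and> d k > 0
     then Max {k. 1 \<le> k \<and> k < top_index d \<and> d k > 0} else 0)"

definition parity_sign :: "(nat \<Rightarrow> nat) \<Rightarrow> int" where
  "parity_sign d = (-1) ^ (\<Sum>k = 1..<top_index d. d k)"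

datatype operation = Op_a | Op_b | Op_c | Op_d | Op_e | Op_f

fun applicable :: "int \<Rightarrow> (nat \<Rightarrow> nat) \<Rightarrow> operation \<Rightarrow> bool" where
  "applicable \<sigma> d Op_a \<longleftrightarrow>
     d (top_index d) = 1 \<and> parity_sign d = - \<sigma>"
| "applicable \<sigma> d Op_b \<longleftrightarrow>
     odd (d (top_index d)) \<and> d (top_index d) \<noteq> 1 \<and> parity_sign d = - \<sigma>"
| "applicable \<sigma> d Op_c \<longleftrightarrow>
     odd (d (top_index d)) \<and> d (second_index d) = 1 \<and> parity_sign d = \<sigma>"
| "applicable \<sigma> d Op_d \<longleftrightarrow>
     odd (d (top_index d)) \<and> d (second_index d) \<noteq> 1 \<and> parity_sign d = \<sigma>"
| "applicable \<sigma> d Op_e \<longleftrightarrow>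
     even (d (top_index d)) \<and> parity_sign d = - \<sigma>"
| "applicable \<sigma> d Op_f \<longleftrightarrow>
     even (d (top_index d)) \<and> parity_sign d = \<sigma>"

text \<open>The truncated subtractions on \<^typ>\<open>nat\<close> in \<open>split_part\<close> and \<open>merge_parts\<close> are genuine
  ones whenever \<open>k \<ge> 1 \<and> d k \<ge> 1\<close> and \<open>d k \<ge> 2\<close>, respectively. For a digit vector of a
  partition and \<open>\<sigma> \<in> {1, -1}\<close>, the applicability conditions guarantee this, except for
  \<open>Op_e\<close> when the partition is empty and \<open>\<sigma> = -1\<close>.\<close>

definition split_part :: "nat \<Rightarrow> (nat \<Rightarrow> nat) \<Rightarrow> nat \<Rightarrow> nat" where
  "split_part k d = d(k := d k - 1, k - 1 := d (k - 1) + 2)"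

definition merge_parts :: "nat \<Rightarrow> (nat \<Rightarrow> nat) \<Rightarrow> nat \<Rightarrow> nat" where
  "merge_parts k d = d(k + 1 := d (k + 1) + 1, k := d k - 2)"

fun transform :: "operation \<Rightarrow> (nat \<Rightarrow> nat) \<Rightarrow> nat \<Rightarrow> nat" where
  "transform Op_a d = split_part (top_index d) d"
| "transform Op_b d = merge_parts (top_index d) d"
| "transform Op_c d = split_part (second_index d) d"
| "transform Op_d d = merge_parts (second_index d) d"
| "transform Op_e d = split_part (top_index d) d"
| "transform Op_f d = merge_parts (top_index d) d"

lemma bp_list_nonempty: "bp_list n \<noteq> []"
proof (induction n rule: less_induct)
  case (less n)
  then show ?case
    by (cases "n = 0") (simp_all add: bp_list.simps[of n] bp_list.simps[of 0])
qed

lemma even_block_nonempty: "even_block (2 * m) \<noteq> []"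
proof (cases "m = 0")
  case True
  then show ?thesis by (simp add: even_block_def bp_list.simps)
next
  case False
  obtain Q where Q: "Q \<in> set (bp_list m)"
    using bp_list_nonempty[of m] by (meson list.set_sel(1))
  have "double Q \<in> set (bp_list (2 * m))"
    using Q False by (auto simp: bp_list.simps[of "2 * m"])
  moreover have "1 \<notin># double Q"
    by (auto simp: double_def)
  ultimately show ?thesis
    by (auto simp: even_block_def filter_empty_conv)
qed

lemma binary_partition_0: "binary_partition 0 P \<longleftrightarrow> P = {#}"
  by (cases P) (auto simp: binary_partition_def)

lemma binary_partition_plus_one:
  "binary_partition (Suc n) (plus_one P) \<longleftrightarrow> binary_partition n P"
  by (auto simp: binary_partition_def plus_one_def intro: exI[of _ "0::nat"])

lemma binary_partition_double:
  assumes "binary_partition n P"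
  shows "binary_partition (2 * n) (double P)"
proof -
  have "\<exists>k. 2 * x = 2 ^ k" if "x \<in># P" for x
    using assms that unfolding binary_partition_def by (metis power_Suc)
  then show ?thesis
    using assms by (auto simp: binary_partition_def double_def simp flip: sum_mset_distrib_left)
qed

lemma binary_partition_cases:
  assumes "binary_partition n P" "n > 0"
  obtains (one) Q where "P = plus_one Q" "binary_partition (n - 1) Q"
  | (even) Q where "even n" "P = double Q" "binary_partition (n div 2) Q"
proof (cases "1 \<in># P")
  case True
  then obtain Q where "P = plus_one Q"
    by (auto simp: plus_one_def dest: multi_member_split)
  with assms binary_partition_plus_one[of "n - 1" Q] one show ?thesis by auto
next
  case False
  define Q where "Q = image_mset (\<lambda>x. x div 2) P"
  have pow: "\<exists>k. x = 2 * 2 ^ k" if x: "x \<in># P" for x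
  proof -
    obtain k where k: "x = 2 ^ k"
      using assms(1) x unfolding binary_partition_def by blast
    with x False show ?thesis by (cases k) auto
  qed
  have P: "P = double Q"
    unfolding double_def Q_def multiset.map_comp
    by (rule sym, rule multiset.map_ident_strong) (use pow in force)
  have sum: "n = 2 * sum_mset Q"
    using assms by (simp add: binary_partition_def P double_def flip: sum_mset_distrib_left)
  have "binary_partition (n div 2) Q"
    unfolding binary_partition_def using sum pow by (fastforce simp: Q_def)
  with P sum even show ?thesis by simp
qed

lemma set_bp_list: "set (bp_list n) = {P. binary_partition n P}"
proof (induction n rule: less_induct)
  case (less n)
  show ?case
  proof (cases "n = 0")
    case True
    then show ?thesis by (simp add: bp_list.simps binary_partition_0)
  next
    case False
    have 1: "set (bp_list (n - 1)) = {P. binary_partition (n - 1) P}"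
      and 2: "set (bp_list (n div 2)) = {P. binary_partition (n div 2) P}"
      using less False by auto
    have eq: "set (bp_list n) = plus_one ` {P. binary_partition (n - 1) P} \<union>
        (if even n then double ` {P. binary_partition (n div 2) P} else {})"
      using False by (auto simp: bp_list.simps[of n] 1[simplified] 2)
    show ?thesis
    proof (intro equalityI subsetI)
      fix P assume "P \<in> set (bp_list n)"
      then show "P \<in> {P. binary_partition n P}"
        using False binary_partition_plus_one[of "n - 1"]
          binary_partition_double[of "n div 2"]
        by (auto simp: eq split: if_splits)
    next
      fix P assume "P \<in> {P. binary_partition n P}"
      then have "binary_partition n P" "n > 0" using False by simp_all
      then show "P \<in> set (bp_list n)"
        by (cases rule: binary_partition_cases) (auto simp: eq)
    qed
  qed
qed

end

theory Submission
  imports Defs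
begin

text \<open>
  Discarding the parts equal to 1 from the entries of \<open>bp_list (2 * m)\<close> yields an initial segment
  of the sequence, so it suffices to study neighbours in this list, by strong induction. Inside the
  last block, neighbours are doubles of neighbours in \<open>bp_list m\<close>, in the same or in the opposite
  order according to the parity of \<open>m\<close>. Doubling shifts the digits by one place and
  turns the number of ones, which has the parity of \<open>m\<close>, into the new digit \<open>d 1\<close>. Hence the sign
  \<open>\<epsilon>\<close> is multiplied by \<open>(-1) ^ m\<close>, and the same part is split or merged with \<open>\<sigma>\<close> replaced by
  \<open>\<sigma> * (-1) ^ m\<close>. The partitions on both sides of a block boundary are explicit: all parts are
  equal, apart from at most one additional part 2.
\<close>

text \<open>Among binary partitions of a fixed total nothing is lost: the number of ones is
  recovered from the total.\<close>

definition strip :: "nat multiset \<Rightarrow> nat multiset" where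
  "strip P = filter_mset (\<lambda>x. x \<noteq> 1) P"

text \<open>No total is fixed, since splitting a part 2 or merging two free ones changes the sum of
  the visible parts by 2.\<close>

definition even_parts :: "nat multiset \<Rightarrow> bool" where
  "even_parts P \<longleftrightarrow> (\<forall>x\<in>#P. \<exists>k\<ge>1. x = 2 ^ k)"

text \<open>Quantifying over all \<open>d\<close> covers every admissible value of the free digit
  \<open>d 0\<close>. Only existence of an operation is asked for; uniqueness comes from
  \<open>applicable_unique\<close>.\<close>

definition step :: "int \<Rightarrow> nat multiset \<Rightarrow> nat multiset \<Rightarrow> bool" where
  "step \<sigma> P P' \<longleftrightarrow>
    (\<forall>d. digits_of P d \<longrightarrow> (\<exists>u. applicable \<sigma> d u \<and> partition_of (transform u d) = P'))"

text \<open>Distinctness belongs to the relation because \<open>step_double\<close> requires it;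
  doubling preserves it, so the induction carries it along.\<close>

definition adjacent :: "nat multiset \<Rightarrow> nat multiset \<Rightarrow> bool" where
  "adjacent P P' \<longleftrightarrow> P \<noteq> P' \<and> step 1 P P' \<and> step (- 1) P' P"

subsection \<open>Digit vectors\<close>

lemma even_parts_count_0:
  assumes "even_parts P" "\<nexists>k. k \<ge> 1 \<and> x = 2 ^ k"
  shows "count P x = 0"
  using assms by (auto simp: even_parts_def not_in_iff[symmetric])

lemma even_parts_eqI:
  assumes "even_parts P" "even_parts Q" "\<And>k. k \<ge> 1 \<Longrightarrow> count P (2 ^ k) = count Q (2 ^ k)"
  shows "P = Q"
proof (rule multiset_eqI)
  fix x
  show "count P x = count Q x"
    using assms even_parts_count_0[of P x] even_parts_count_0[of Q x]
    by (cases "\<exists>k\<ge>1. x = 2 ^ k") auto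
qed

lemma even_parts_partition_of:
  assumes "finite {k. d k > 0}"
  shows "even_parts (partition_of d)"
  unfolding even_parts_def
proof
  fix x assume "x \<in># partition_of d"
  then have "x \<noteq> 1" "x \<in># (\<Sum>k | d k > 0. replicate_mset (d k) (2 ^ k))"
    by (auto simp: partition_of_def)
  then obtain k where "x = 2 ^ k"
    using assms by (auto simp: set_mset_sum split: if_splits)
  with \<open>x \<noteq> 1\<close> show "\<exists>k\<ge>1. x = 2 ^ k"
    by (intro exI[of _ k]) (cases k; simp)
qed

lemma count_partition_of:
  assumes "finite {k. d k > 0}" "k \<ge> 1"
  shows "count (partition_of d) (2 ^ k) = d k"
proof -
  have "(2::nat) ^ k \<noteq> 1" using assms(2) by simp
  then have "count (partition_of d) (2 ^ k)
      = (\<Sum>l | d l > 0. count (replicate_mset (d l) ((2::nat) ^ l)) (2 ^ k))"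
    by (simp add: partition_of_def count_sum)
  also have "\<dots> = (\<Sum>l | d l > 0. if l = k then d l else 0)"
    by (intro sum.cong) auto
  also have "\<dots> = d k"
    using assms(1) by (simp add: sum.delta)
  finally show ?thesis .
qed

lemma partition_of_eqI:
  assumes "finite {k. d k > 0}" "even_parts P" "\<And>k. k \<ge> 1 \<Longrightarrow> d k = count P (2 ^ k)"
  shows "partition_of d = P"
  using assms by (intro even_parts_eqI even_parts_partition_of) (auto simp: count_partition_of)

lemma digits_of_finite:
  assumes "digits_of P d"
  shows "finite {k. d k > 0}"
proof -
  have "{k. d k > 0} \<subseteq> insert 0 {k. (2::nat) ^ k \<in># P}"
  proof
    fix k assume "k \<in> {k. d k > 0}"
    then show "k \<in> insert 0 {k. (2::nat) ^ k \<in># P}"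
      using assms by (cases "k = 0") (auto simp: digits_of_def)
  qed
  moreover have "finite {k. (2::nat) ^ k \<in># P}"
    using finite_vimageI[of "set_mset P" "\<lambda>k. (2::nat) ^ k"] by (simp add: vimage_def inj_on_def)
  ultimately show ?thesis
    by (meson finite.insertI finite_subset)
qed

lemma partition_of_digits:
  assumes "digits_of P d" "even_parts P"
  shows "partition_of d = P"
  using assms by (intro partition_of_eqI digits_of_finite[OF assms(1)]) (auto simp: digits_of_def)

section \<open>Effect of splitting and merging on the counts and on the total\<close>

lemma split_part_apply:
  "k \<ge> 1 \<Longrightarrow> split_part k d l = (if l = k then d k - 1 else if Suc l = k then d l + 2 else d l)"
  by (auto simp: split_part_def)

lemma merge_parts_apply:
  "merge_parts k d l = (if l = k then d k - 2 else if l = Suc k then d l + 1 else d l)"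
  by (auto simp: merge_parts_def)

lemma finite_fun_upd_pos:
  fixes d :: "nat \<Rightarrow> nat"
  assumes "finite {k. d k > 0}"
  shows "finite {k. (d(a := x)) k > 0}"
  by (rule finite_subset[of _ "insert a {k. d k > 0}"]) (use assms in auto)

lemma finite_split_part: "finite {k. d k > 0} \<Longrightarrow> finite {l. split_part k d l > 0}"
  unfolding split_part_def by (intro finite_fun_upd_pos)

lemma finite_merge_parts: "finite {k. d k > 0} \<Longrightarrow> finite {l. merge_parts k d l > 0}"
  unfolding merge_parts_def by (intro finite_fun_upd_pos)

lemma even_parts_add [simp]: "even_parts (P + Q) \<longleftrightarrow> even_parts P \<and> even_parts Q"
  by (auto simp: even_parts_def)

lemma even_parts_add_mset [simp]: "k \<ge> 1 \<Longrightarrow> even_parts (add_mset (2 ^ k) P) \<longleftrightarrow> even_parts P"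
  by (auto simp: even_parts_def)

lemma even_parts_replicate [simp]: "k \<ge> 1 \<Longrightarrow> even_parts (replicate_mset n (2 ^ k))"
  by (auto simp: even_parts_def)

lemma even_parts_empty [simp]: "even_parts {#}"
  by (simp add: even_parts_def)

lemmas even_parts_partition_of_ops =
  even_parts_partition_of[OF finite_split_part] even_parts_partition_of[OF finite_merge_parts]

lemmas count_partition_of_ops =
  count_partition_of[OF finite_split_part] count_partition_of[OF finite_merge_parts]

text \<open>One part becomes two of half its size, so the total is kept unless \<open>k = 1\<close>,
  when the two new ones are discarded. The total later determines the number of ones, which
  stripping hides.\<close>

lemma sum_partition_of_split_part:
  assumes "finite {k. d k > 0}" "k \<ge> 1" "d k \<ge> 1"
  shows "\<Sum>\<^sub># (partition_of (split_part k d)) + (if k = 1 then 2 else 0) = \<Sum>\<^sub># (partition_of d)"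
proof -
  \<comment> \<open>The part lost is added on the left and the parts gained on the right, so that
    counts are compared without subtraction.\<close>
  have "partition_of (split_part k d) + replicate_mset 1 (2 ^ k)
      = partition_of d + (if k = 1 then {#} else replicate_mset 2 (2 ^ (k - 1)))" (is "?l = ?r")
  proof (rule even_parts_eqI)
    show "even_parts ?l" "even_parts ?r"
      using assms by (simp_all add: even_parts_partition_of even_parts_partition_of_ops)
    fix l :: nat assume "l \<ge> 1"
    then show "count ?l (2 ^ l) = count ?r (2 ^ l)"
      using assms
      by (simp add: count_partition_of count_partition_of_ops) (auto simp: split_part_apply)
  qed
  from arg_cong[OF this, of sum_mset] show ?thesis
    using assms(2) by (cases k) (auto split: if_splits)
qed

text \<open>For \<open>k = 0\<close> the two merged ones were never counted, so the total grows by
  the new part 2.\<close>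

lemma sum_partition_of_merge_parts:
  assumes "finite {k. d k > 0}" "d k \<ge> 2"
  shows "\<Sum>\<^sub># (partition_of (merge_parts k d)) = \<Sum>\<^sub># (partition_of d) + (if k = 0 then 2 else 0)"
proof -
  have "partition_of (merge_parts k d) + (if k = 0 then {#} else replicate_mset 2 (2 ^ k))
      = partition_of d + replicate_mset 1 (2 ^ Suc k)" (is "?l = ?r")
  proof (rule even_parts_eqI)
    show "even_parts ?l" "even_parts ?r"
      using assms
      by (simp_all add: even_parts_partition_of even_parts_partition_of_ops del: power_Suc)
    fix l :: nat assume "l \<ge> 1"
    then show "count ?l (2 ^ l) = count ?r (2 ^ l)"
      using assms
      by (simp add: count_partition_of count_partition_of_ops del: power_Suc)
        (auto simp: merge_parts_apply simp del: power_Suc)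
  qed
  from arg_cong[OF this, of sum_mset] show ?thesis
    by (auto split: if_splits)
qed

section \<open>Largest and second-largest part sizes, the sign, and uniqueness of the
  operation\<close>

lemma top_index_eqI:
  assumes "i \<ge> 1" "d i > 0" "\<And>k. k > i \<Longrightarrow> d k = 0"
  shows "top_index d = i"
proof -
  have fin: "finite {k. 1 \<le> k \<and> d k > 0}"
    by (rule finite_subset[of _ "{..i}"]) (use assms(3) in \<open>auto simp: not_less[symmetric]\<close>)
  have "Max {k. 1 \<le> k \<and> d k > 0} = i"
    by (rule Max_eqI[OF fin]) (use assms in \<open>auto simp: not_less[symmetric]\<close>)
  then show ?thesis
    using assms by (auto simp: top_index_def)
qed

lemma top_index_eq_0I: "(\<And>k. k \<ge> 1 \<Longrightarrow> d k = 0) \<Longrightarrow> top_index d = 0"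
  by (auto simp: top_index_def)

lemma top_index_pos:
  assumes "finite {k. d k > 0}" "k \<ge> 1" "d k > 0"
  shows "top_index d \<ge> 1" "d (top_index d) > 0" "\<And>l. l > top_index d \<Longrightarrow> d l = 0"
proof -
  let ?A = "{k. 1 \<le> k \<and> d k > 0}"
  have fin: "finite ?A" by (rule finite_subset[OF _ assms(1)]) auto
  have top: "top_index d = Max ?A" using assms by (auto simp: top_index_def)
  have "Max ?A \<in> ?A" by (rule Max_in[OF fin]) (use assms in auto)
  then show "top_index d \<ge> 1" "d (top_index d) > 0" by (auto simp: top)
  fix l assume "l > top_index d"
  then show "d l = 0" using Max_ge[OF fin, of l] \<open>top_index d \<ge> 1\<close> top by (cases "d l = 0") auto
qed

lemma second_index_eqI:
  assumes "j \<ge> 1" "j < top_index d" "d j > 0" "\<And>k. j < k \<Longrightarrow> k < top_index d \<Longrightarrow> d k = 0"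
  shows "second_index d = j"
proof -
  have fin: "finite {k. 1 \<le> k \<and> k < top_index d \<and> d k > 0}"
    by (rule finite_subset[of _ "{..top_index d}"]) auto
  have "Max {k. 1 \<le> k \<and> k < top_index d \<and> d k > 0} = j"
    by (rule Max_eqI[OF fin]) (use assms in \<open>auto simp: not_less[symmetric]\<close>)
  then show ?thesis
    using assms by (auto simp: second_index_def)
qed

lemma second_index_eq_0I:
  "(\<And>k. k \<ge> 1 \<Longrightarrow> k < top_index d \<Longrightarrow> d k = 0) \<Longrightarrow> second_index d = 0"
  by (auto simp: second_index_def)

lemma second_index_pos:
  assumes "k \<ge> 1" "k < top_index d" "d k > 0"
  shows "second_index d \<ge> 1" "second_index d < top_index d" "d (second_index d) > 0"
    "\<And>l. l > second_index d \<Longrightarrow> l < top_index d \<Longrightarrow> d l = 0"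
proof -
  let ?A = "{k. 1 \<le> k \<and> k < top_index d \<and> d k > 0}"
  have fin: "finite ?A" by (rule finite_subset[of _ "{..top_index d}"]) auto
  have sec: "second_index d = Max ?A" using assms by (auto simp: second_index_def)
  have "Max ?A \<in> ?A" by (rule Max_in[OF fin]) (use assms in auto)
  then show "second_index d \<ge> 1" "second_index d < top_index d" "d (second_index d) > 0"
    by (auto simp: sec)
  fix l assume l: "l > second_index d" "l < top_index d"
  then have "l \<notin> ?A" using Max_ge[OF fin, of l] unfolding sec by linarith
  then show "d l = 0" using l \<open>second_index d \<ge> 1\<close> by simp
qed

text \<open>Here \<open>e\<close> is \<open>d\<close> shifted down by one place, with
  \<open>e 0\<close> left free. The digit \<open>d 1\<close> is the only additional term in the sign
  of \<open>d\<close>, and it takes the second place when \<open>e\<close> has no second-largest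
  part.\<close>

lemma top_second_shift:
  assumes fin: "finite {k. d k > 0}" and e: "\<And>k. k \<ge> 1 \<Longrightarrow> e k = d (Suc k)"
    and ex: "k \<ge> 1" "e k > 0"
  shows "top_index d = Suc (top_index e)"
    and "second_index d =
      (if second_index e > 0 then Suc (second_index e) else if d 1 > 0 then 1 else 0)"
    and "parity_sign d = (- 1) ^ d 1 * parity_sign e"
proof -
  have "finite (Suc -` {k. d k > 0})" by (rule finite_vimageI[OF fin]) auto
  then have "finite (insert 0 (Suc -` {k. d k > 0}))" by simp
  moreover have "{k. e k > 0} \<subseteq> insert 0 (Suc -` {k. d k > 0})"
  proof
    fix k assume "k \<in> {k. e k > 0}"
    then show "k \<in> insert 0 (Suc -` {k. d k > 0})" using e[of k] by (cases "k = 0") auto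
  qed
  ultimately have fin_e: "finite {k. e k > 0}" by (rule finite_subset[rotated])
  note t = top_index_pos[OF fin_e ex]
  have d: "d k = e (k - 1)" if "k \<ge> 2" for k using that e[of "k - 1"] by simp
  show top: "top_index d = Suc (top_index e)"
    by (rule top_index_eqI) (use t d in auto)
  show "second_index d =
      (if second_index e > 0 then Suc (second_index e) else if d 1 > 0 then 1 else 0)"
  proof (cases "\<exists>k\<ge>1. k < top_index e \<and> e k > 0")
    case True
    then obtain l where "l \<ge> 1" "l < top_index e" "e l > 0" by auto
    note s = second_index_pos[OF this]
    have "second_index d = Suc (second_index e)"
      by (rule second_index_eqI) (use s d top in auto)
    then show ?thesis using s by simp
  next
    case False
    then have s: "second_index e = 0" by (auto simp: second_index_def)
    have 0: "d l = 0" if "1 < l" "l < top_index d" for l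
      using False that d[of l] top by (auto dest: spec[of _ "l - 1"])
    show ?thesis
    proof (cases "d 1 > 0")
      case True
      then have "second_index d = 1"
        by (intro second_index_eqI) (use 0 t top in auto)
      then show ?thesis using s True by simp
    next
      case False
      have "second_index d = 0"
      proof (rule second_index_eq_0I)
        fix k :: nat assume "k \<ge> 1" "k < top_index d"
        then show "d k = 0" using False 0[of k] by (cases "k = 1") auto
      qed
      then show ?thesis using s False by simp
    qed
  qed
  \<comment> \<open>The top index of \<open>d\<close> is at least 2, so the term \<open>d 1\<close>
    can be split off.\<close>
  have "(\<Sum>k = 1..<top_index d. d k) = d 1 + (\<Sum>k = Suc 1..<Suc (top_index e). d k)"
    unfolding top using t(1) by (subst sum.atLeast_Suc_lessThan) auto
  also have "(\<Sum>k = Suc 1..<Suc (top_index e). d k) = (\<Sum>k = 1..<top_index e. e k)"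
    unfolding sum.shift_bounds_Suc_ivl by (intro sum.cong) (auto simp: e)
  finally show "parity_sign d = (- 1) ^ d 1 * parity_sign e"
    by (simp add: parity_sign_def power_add)
qed

lemma parity_sign_cases: "parity_sign d = 1 \<or> parity_sign d = - 1"
  unfolding parity_sign_def by (cases "even (\<Sum>k = 1..<top_index d. d k)") auto

text \<open>The conditions branch on the sign, the parity of the top digit, and whether the relevant
  digit equals 1; since \<sigma> is nonzero, the two signs exclude each other.\<close>

lemma applicable_unique:
  assumes "\<sigma> = 1 \<or> \<sigma> = - 1"
  shows "\<exists>!u. applicable \<sigma> d u"
proof -
  have ex1: "\<exists>!u. P u" if "P v" "\<And>w. w \<noteq> v \<Longrightarrow> \<not> P w" for P and v :: operation
    using that by metis
  consider "parity_sign d = - \<sigma>" "d (top_index d) = 1"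
    | "parity_sign d = - \<sigma>" "odd (d (top_index d))" "d (top_index d) \<noteq> 1"
    | "parity_sign d = \<sigma>" "odd (d (top_index d))" "d (second_index d) = 1"
    | "parity_sign d = \<sigma>" "odd (d (top_index d))" "d (second_index d) \<noteq> 1"
    | "parity_sign d = - \<sigma>" "even (d (top_index d))"
    | "parity_sign d = \<sigma>" "even (d (top_index d))"
    using assms parity_sign_cases[of d] by (metis equation_minus_iff)
  then show ?thesis
  proof cases
    case 1 then show ?thesis using assms
      by (intro ex1[of _ Op_a]) (simp, rename_tac w, case_tac w, auto)
  next
    case 2 then show ?thesis using assms
      by (intro ex1[of _ Op_b]) (simp, rename_tac w, case_tac w, auto)
  next
    case 3 then show ?thesis using assms
      by (intro ex1[of _ Op_c]) (simp, rename_tac w, case_tac w, auto)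
  next
    case 4 then show ?thesis using assms
      by (intro ex1[of _ Op_d]) (simp, rename_tac w, case_tac w, auto)
  next
    case 5 then show ?thesis using assms
      by (intro ex1[of _ Op_e]) (simp, rename_tac w, case_tac w, auto)
  next
    case 6 then show ?thesis using assms
      by (intro ex1[of _ Op_f]) (simp, rename_tac w, case_tac w, auto)
  qed
qed

subsection \<open>Doubling\<close>

lemma strip_double [simp]: "strip (double P) = double P"
  by (auto simp: strip_def double_def filter_mset_eq_conv)

lemma strip_plus_one [simp]: "strip (plus_one P) = strip P"
  by (simp add: strip_def plus_one_def)

lemma count_double: "count (double P) (2 * x) = count P x"
  unfolding double_def by (induction P) auto

lemma double_inject [simp]: "double P = double Q \<longleftrightarrow> P = Q"
  by (metis count_double multiset_eqI)

lemma even_parts_strip: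
  assumes "binary_partition n P"
  shows "even_parts (strip P)"
  unfolding even_parts_def
proof
  fix x assume "x \<in># strip P"
  then have "x \<noteq> 1" "x \<in># P" by (auto simp: strip_def)
  then obtain k where "x = 2 ^ k" using assms by (auto simp: binary_partition_def)
  with \<open>x \<noteq> 1\<close> show "\<exists>k\<ge>1. x = 2 ^ k" by (cases k) auto
qed

lemma even_parts_double: "binary_partition n P \<Longrightarrow> even_parts (double P)"
  by (metis binary_partition_double even_parts_strip strip_double)

lemma sum_strip: "\<Sum>\<^sub># (strip P) + count P 1 = \<Sum>\<^sub># P"
proof -
  have "P = strip P + replicate_mset (count P 1) 1"
    by (rule multiset_eqI) (simp add: strip_def)
  from arg_cong[OF this, of sum_mset] show ?thesis by simp
qed

text \<open>Hence the number of ones in a binary partition of \<open>m\<close> has the parity of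
  \<open>m\<close>, which turns the sign factor from \<open>d 1\<close> into
  \<open>(- 1) ^ m\<close>.\<close>

lemma even_sum_even_parts:
  assumes "even_parts P"
  shows "even (\<Sum>\<^sub># P)"
proof -
  have "even x" if "x \<in># P" for x
    using assms that by (auto simp: even_parts_def)
  then show ?thesis
    by (induction P) auto
qed

text \<open>The inequality excludes \<open>Op_e\<close> on the empty partition with \<open>\<sigma> = -1\<close>, where truncated
  subtraction makes \<open>split_part 0\<close> fix the empty partition.\<close>

lemma step_double:
  assumes X: "binary_partition m X" and X': "binary_partition m X'"
    and step: "step \<sigma> (strip X) (strip X')" and ne: "strip X \<noteq> strip X'"
  shows "step (\<sigma> * (- 1) ^ m) (double X) (double X')"
  unfolding step_def
proof (intro allI impI)
  fix d assume dig: "digits_of (double X) d"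
  note fin = digits_of_finite[OF dig]
  \<comment> \<open>Shifting \<open>d\<close> back gives a digit vector of \<open>strip X\<close>.
    Its free digit may be any admissible value; 2 is chosen.\<close>
  define e where "e = (\<lambda>k. if k = 0 then 2 else d (Suc k))"
  have e0: "e 0 = 2" and e: "\<And>k. k \<ge> 1 \<Longrightarrow> e k = d (Suc k)" by (auto simp: e_def)
  have d: "d (Suc k) = count X (2 ^ k)" for k
    using dig count_double[of X "2 ^ k"] by (simp add: digits_of_def)
  have d1: "d 1 = count X 1" using d[of 0] by simp
  have cstrip: "count (strip Y) (2 ^ k) = count Y (2 ^ k)" if "k \<ge> 1" for Y k
    using that by (simp add: strip_def)
  have dig_e: "digits_of (strip X) e"
    by (auto simp: digits_of_def e_def d cstrip)
  note fin_e = digits_of_finite[OF dig_e]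
  have part_e: "partition_of e = strip X"
    by (rule partition_of_digits[OF dig_e even_parts_strip[OF X]])
  obtain u where u: "applicable \<sigma> e u" "partition_of (transform u e) = strip X'"
    using step dig_e by (auto simp: step_def)
  have sumX: "\<Sum>\<^sub># (strip X) + d 1 = m" and sumX': "\<Sum>\<^sub># (strip X') + count X' 1 = m"
    using X X' sum_strip[of X] sum_strip[of X'] unfolding d1 binary_partition_def by auto
  have parity: "(- 1) ^ m = (- 1 :: int) ^ d 1"
    using even_sum_even_parts[OF even_parts_strip[OF X]]
    by (simp flip: sumX add: power_add)

  \<comment> \<open>An operation on \<open>e\<close> lifts to \<open>d\<close> one place higher.
    Places above 1 are read off \<open>strip X'\<close>; place 1 counts the ones of
    \<open>X'\<close>, which are recovered from the common total \<open>m\<close>.\<close>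
  have split: "partition_of (split_part (Suc k) d) = double X'"
    if k: "k \<ge> 1" "e k \<ge> 1" "partition_of (split_part k e) = strip X'" for k
  proof (rule partition_of_eqI[OF finite_split_part[OF fin] even_parts_double[OF X']])
    fix l :: nat assume "l \<ge> 1"
    then obtain l' where l: "l = Suc l'" by (cases l) auto
    show "split_part (Suc k) d l = count (double X') (2 ^ l)"
    proof (cases "l' = 0")
      case True
      have "\<Sum>\<^sub># (strip X') + (if k = 1 then 2 else 0) = \<Sum>\<^sub># (strip X)"
        using sum_partition_of_split_part[OF fin_e k(1,2)] k(3) part_e by simp
      then show ?thesis
        using True l count_double[of X' 1] sumX sumX' k(1) by (auto simp: split_part_apply)
    next
      case False
      then have "count (strip X') (2 ^ l') = split_part k e l'"
        using count_partition_of_ops(1)[OF fin_e, of l' k] k(3) by simp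
      then show ?thesis
        using False l k(1) e by (auto simp: count_double cstrip split_part_apply)
    qed
  qed
  txt \<open>Merging two parts 1 that \<open>X\<close> does not have would lead outside the partitions of \<open>m\<close>.\<close>
  have d1_ge_2: "d 1 \<ge> 2" if "partition_of (merge_parts 0 e) = strip X'"
    using sum_partition_of_merge_parts[OF fin_e, of 0] that e0 part_e sumX sumX' by simp
  have merge: "partition_of (merge_parts (Suc k) d) = double X'"
    if k: "e k \<ge> 2" "partition_of (merge_parts k e) = strip X'" for k
  proof (rule partition_of_eqI[OF finite_merge_parts[OF fin] even_parts_double[OF X']])
    fix l :: nat assume "l \<ge> 1"
    then obtain l' where l: "l = Suc l'" by (cases l) auto
    show "merge_parts (Suc k) d l = count (double X') (2 ^ l)"
    proof (cases "l' = 0")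
      case True
      have "\<Sum>\<^sub># (strip X') = \<Sum>\<^sub># (strip X) + (if k = 0 then 2 else 0)"
        using sum_partition_of_merge_parts[OF fin_e k(1)] k(2) part_e by simp
      then show ?thesis
        using True l count_double[of X' 1] sumX sumX' by (auto simp: merge_parts_apply)
    next
      case False
      then have "count (strip X') (2 ^ l') = merge_parts k e l'"
        using count_partition_of_ops(2)[OF fin_e, of l' k] k(2) by simp
      then show ?thesis
        using False l e by (auto simp: count_double cstrip merge_parts_apply)
    qed
  qed
  show "\<exists>u. applicable (\<sigma> * (- 1) ^ m) d u \<and> partition_of (transform u d) = double X'"
  proof (cases "\<exists>k\<ge>1. e k > 0")
    case True
    then obtain k where "k \<ge> 1" "e k > 0" by auto
    note t = top_index_pos[OF fin_e this] and shift = top_second_shift[OF fin e this]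
    let ?i = "top_index e" and ?j = "second_index e"
    \<comment> \<open>Without a second-largest part, \<open>?j = 0\<close> and the free digit
      \<open>e 0 = 2\<close> is positive.\<close>
    have j: "e ?j > 0"
      using second_index_pos(3)[of _ e] second_index_eq_0I[of e] e0
      by (cases "\<exists>k\<ge>1. k < ?i \<and> e k > 0") auto
    have di: "d (top_index d) = e ?i"
      using shift(1) e t(1) by simp
    have dj: "d (second_index d) = e ?j" "second_index d = Suc ?j" if "?j \<ge> 1"
      using shift(2) e that by auto
    have sign: "(parity_sign d = \<sigma> * (- 1) ^ m \<longleftrightarrow> parity_sign e = \<sigma>) \<and>
      (parity_sign d = - (\<sigma> * (- 1) ^ m) \<longleftrightarrow> parity_sign e = - \<sigma>)"
    proof (cases "even (d 1)")
      case True
      then show ?thesis using shift(3) parity by simp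
    next
      case False
      then have "parity_sign d = - parity_sign e" "(- 1 :: int) ^ m = - 1"
        using shift(3) parity by auto
      then show ?thesis by simp linarith
    qed
    \<comment> \<open>The same operation serves \<open>d\<close>: the top digits agree, and the sign
      changes together with \<sigma>.\<close>
    have "applicable (\<sigma> * (- 1) ^ m) d u \<and> partition_of (transform u d) = double X'"
    proof (cases u)
      case Op_c
      then have "?j \<noteq> 0" using u(1) e0 by (metis applicable.simps(3) numeral_eq_one_iff semiring_norm(85))
      then show ?thesis
        using u Op_c sign di dj split[of ?j] by auto
    next
      \<comment> \<open>If \<open>?j = 0\<close>, the free ones of \<open>e\<close> correspond to
        digit 1 of \<open>d\<close>, which is then the second-largest one; \<open>d1_ge_2\<close>
        provides two parts to merge.\<close>
      case Op_d
      show ?thesis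
      proof (cases "?j = 0")
        case True
        then have "d 1 \<ge> 2" using d1_ge_2 u Op_d by simp
        then show ?thesis
          using u Op_d sign di shift(2) merge[of 0] True e0 by auto
      next
        case False
        then show ?thesis
          using u Op_d sign di dj merge[of ?j] j by auto
      qed
    next
      case Op_b
      then have "e ?i \<ge> 2" using u(1) t(2) by simp
      then show ?thesis using u Op_b sign di shift(1) merge[of ?i] by auto
    next
      case Op_f
      then have "e ?i \<ge> 2" using u(1) t(2) by (cases "e ?i = 1") auto
      then show ?thesis using u Op_f sign di shift(1) merge[of ?i] by auto
    qed (use u t sign di shift(1) split[of ?i] in auto)
    then show ?thesis by blast
  next
    \<comment> \<open>\<open>X\<close> has only ones, which become the largest parts in
      \<open>d\<close>. Only \<open>Op_f\<close> is possible for \<open>e\<close>; for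
      \<open>d\<close> it turns into \<open>Op_f\<close> or \<open>Op_b\<close> according to the
      parity of their number.\<close>
    case False
    then have e_eq_0: "e k = 0" if "k \<ge> 1" for k using that by auto
    have top_e: "top_index e = 0" by (rule top_index_eq_0I[OF e_eq_0])
    then have sign_e: "parity_sign e = 1" by (simp add: parity_sign_def)
    have "strip X = {#}"
      by (rule even_parts_eqI[OF even_parts_strip[OF X]])
        (use e_eq_0 dig_e in \<open>auto simp: digits_of_def\<close>)
    moreover have "partition_of (split_part 0 e) = {#}"
      by (rule partition_of_eqI)
        (use e_eq_0 in \<open>auto simp: split_part_def intro!: finite_fun_upd_pos fin_e\<close>)
    ultimately have "u = Op_f" using u ne top_e e0 by (cases u) auto
    with u top_e e0 sign_e have u': "\<sigma> = 1" "partition_of (merge_parts 0 e) = strip X'" by auto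
    note d1_ge = d1_ge_2[OF u'(2)]
    have top_d: "top_index d = 1"
    proof (rule top_index_eqI)
      fix k :: nat assume "k > 1"
      then show "d k = 0" using e[of "k - 1"] e_eq_0[of "k - 1"] by simp
    qed (use d1_ge in auto)
    have "applicable (\<sigma> * (- 1) ^ m) d (if even (d 1) then Op_f else Op_b)"
      using top_d u'(1) d1_ge by (auto simp: parity_sign_def parity)
    moreover have "partition_of (transform (if even (d 1) then Op_f else Op_b) d) = double X'"
      using top_d merge[OF _ u'(2)] e0 by auto
    ultimately show ?thesis by blast
  qed
qed

text \<open>For odd \<open>m\<close> the factor \<open>(- 1) ^ m\<close> exchanges successor and
  predecessor, which matches the reversed listing of the block of \<open>2 * m\<close>.\<close>

lemma adjacent_double:
  assumes "binary_partition m X" "binary_partition m X'" "adjacent (strip X) (strip X')"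
  shows "if even m then adjacent (double X) (double X') else adjacent (double X') (double X)"
proof -
  have ne: "strip X \<noteq> strip X'" "strip X' \<noteq> strip X"
    and steps: "step 1 (strip X) (strip X')" "step (- 1) (strip X') (strip X)"
    using assms(3) by (auto simp: adjacent_def)
  show ?thesis
    using step_double[OF assms(1,2) steps(1) ne(1)] step_double[OF assms(2,1) steps(2) ne(2)] ne
    by (auto simp: adjacent_def)
qed

subsection \<open>Block boundaries\<close>

text \<open>The merged ones come from the unlimited supply, so a part 2 appears and nothing visible
  is lost.\<close>

lemma partition_of_merge_0:
  assumes "even_parts P" "digits_of P d"
  shows "partition_of (merge_parts 0 d) = add_mset 2 P"
proof (rule partition_of_eqI[OF finite_merge_parts[OF digits_of_finite[OF assms(2)]]])
  show "even_parts (add_mset 2 P)"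
    using assms(1) even_parts_add_mset[of 1 P] by simp
  show "merge_parts 0 d k = count (add_mset 2 P) (2 ^ k)" if "k \<ge> 1" for k
    using that assms(2) power_inject_exp[of "2::nat" 1 k]
    by (auto simp: merge_parts_apply digits_of_def)
qed

lemma partition_of_split_1:
  assumes "even_parts P" "digits_of (add_mset 2 P) d"
  shows "partition_of (split_part 1 d) = P"
proof (rule partition_of_eqI[OF finite_split_part[OF digits_of_finite[OF assms(2)]] assms(1)])
  show "split_part 1 d k = count P (2 ^ k)" if "k \<ge> 1" for k
    using that assms(2) power_inject_exp[of "2::nat" 1 k]
    by (auto simp: split_part_apply digits_of_def)
qed

lemma top_index_replicate:
  assumes "digits_of (replicate_mset q (2 ^ i)) d" "q > 0" "i \<ge> 1"
  shows "top_index d = i" "second_index d = 0" "parity_sign d = 1" "d i = q"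
proof -
  have d: "d k = (if k = i then q else 0)" if "k \<ge> 1" for k
    using assms(1) that by (auto simp: digits_of_def)
  show top: "top_index d = i"
    by (rule top_index_eqI) (use d assms in auto)
  show "second_index d = 0"
    by (rule second_index_eq_0I) (use d top in auto)
  show "d i = q" using d assms(3) by simp
  show "parity_sign d = 1"
    by (simp add: parity_sign_def top d)
qed

text \<open>The sign is 1 and there is no second-largest part, so two free ones merge by
  \<open>Op_d\<close>; backwards, the even top digit selects \<open>Op_e\<close>.\<close>

lemma adjacent_all_twos:
  assumes "odd k"
  shows "adjacent (replicate_mset k 2) (replicate_mset (Suc k) 2)"
  unfolding adjacent_def
proof (intro conjI)
  have k: "k > 0" using assms by (rule odd_pos)
  have even_parts: "even_parts (replicate_mset k 2)"
    using even_parts_replicate[of 1 k] by simp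
  show "replicate_mset k 2 \<noteq> replicate_mset (Suc k) (2::nat)" by (simp add: replicate_mset_eq_iff)
  show "step 1 (replicate_mset k 2) (replicate_mset (Suc k) 2)"
    unfolding step_def
  proof (intro allI impI exI[of _ Op_d])
    fix d assume d: "digits_of (replicate_mset k 2) d"
    note top = top_index_replicate[of k 1 d, simplified, OF d k]
    from d have "d 0 \<noteq> 1" by (auto simp: digits_of_def)
    then show "applicable 1 d Op_d \<and>
        partition_of (transform Op_d d) = replicate_mset (Suc k) 2"
      using top assms partition_of_merge_0[OF even_parts d] by simp
  qed
  show "step (- 1) (replicate_mset (Suc k) 2) (replicate_mset k 2)"
    unfolding step_def
  proof (intro allI impI exI[of _ Op_e])
    fix d assume d: "digits_of (replicate_mset (Suc k) 2) d"
    note top = top_index_replicate[of "Suc k" 1 d, simplified, OF d[simplified]]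
    show "applicable (- 1) d Op_e \<and>
        partition_of (transform Op_e d) = replicate_mset k 2"
      using top assms partition_of_split_1[OF even_parts, of d] d by simp
  qed
qed

text \<open>The boundary after the block of 0. The top index is 0, so the even free digit itself
  selects \<open>Op_f\<close>; backwards, \<open>Op_a\<close> splits the single 2.\<close>

lemma adjacent_empty: "adjacent {#} {#2#}"
  unfolding adjacent_def
proof (intro conjI)
  show "step 1 {#} {#2#}"
    unfolding step_def
  proof (intro allI impI exI[of _ Op_f])
    fix d assume d: "digits_of {#} d"
    have "top_index d = 0"
      by (rule top_index_eq_0I) (use d in \<open>auto simp: digits_of_def\<close>)
    moreover have "even (d 0)" using d by (simp add: digits_of_def)
    ultimately show "applicable 1 d Op_f \<and> partition_of (transform Op_f d) = {#2#}"
      using partition_of_merge_0[OF _ d] by (simp add: parity_sign_def)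
  qed
  show "step (- 1) {#2#} {#}"
    unfolding step_def
  proof (intro allI impI exI[of _ Op_a])
    fix d assume d: "digits_of {#2#} d"
    note top = top_index_replicate[of 1 1 d, simplified, OF d]
    show "applicable (- 1) d Op_a \<and> partition_of (transform Op_a d) = {#}"
      using top partition_of_split_1[of "{#}" d] d by simp
  qed
qed simp

text \<open>A single additional 2 flips the sign, so \<open>Op_d\<close> on the free ones is undone
  by \<open>Op_c\<close> on that 2.\<close>

lemma adjacent_add_2:
  assumes "odd q" "i \<ge> 2"
  shows "adjacent (replicate_mset q (2 ^ i)) (add_mset 2 (replicate_mset q (2 ^ i)))"
    (is "adjacent ?P _")
  unfolding adjacent_def
proof (intro conjI)
  have q: "q > 0" using assms(1) by (rule odd_pos)
  have i: "i \<ge> 1" using assms(2) by simp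
  note even_parts = even_parts_replicate[OF i, of q]
  show "?P \<noteq> add_mset 2 ?P" by simp
  show "step 1 ?P (add_mset 2 ?P)"
    unfolding step_def
  proof (intro allI impI exI[of _ Op_d])
    fix d assume d: "digits_of ?P d"
    note top = top_index_replicate[OF d q i]
    from d have "d 0 \<noteq> 1" by (auto simp: digits_of_def)
    then show "applicable 1 d Op_d \<and> partition_of (transform Op_d d) = add_mset 2 ?P"
      using top assms partition_of_merge_0[OF even_parts d] by simp
  qed
  show "step (- 1) (add_mset 2 ?P) ?P"
    unfolding step_def
  proof (intro allI impI exI[of _ Op_c])
    fix d assume d: "digits_of (add_mset 2 ?P) d"
    have dk: "d k = (if k = i then q else if k = 1 then 1 else 0)" if "k \<ge> 1" for k
      using d that assms(2) power_inject_exp[of "2::nat" 1 k] power_inject_exp[of "2::nat" 1 i]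
      by (auto simp: digits_of_def)
    have top: "top_index d = i"
      by (rule top_index_eqI) (use dk q i in auto)
    have second: "second_index d = 1"
      by (rule second_index_eqI) (use dk top assms(2) in auto)
    have "(\<Sum>k = 1..<i. d k) = (\<Sum>k = 1..<i. if k = 1 then 1 else 0)"
      by (intro sum.cong) (auto simp: dk)
    also have "\<dots> = 1" using assms(2) by simp
    finally have "parity_sign d = - 1" by (simp add: parity_sign_def top)
    then show "applicable (- 1) d Op_c \<and> partition_of (transform Op_c d) = ?P"
      using top second dk[of i] dk[of 1] i assms partition_of_split_1[OF even_parts d] by simp
  qed
qed

subsection \<open>The lists of binary partitions\<close>

lemma bp_list_0 [simp]: "bp_list 0 = [{#}]"
  by (simp add: bp_list.simps)

lemma bp_list_odd: "bp_list (Suc (2 * k)) = map plus_one (bp_list (2 * k))"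
  by (subst bp_list.simps) simp

text \<open>For \<open>2 * Suc k\<close>, divisibility by 4 means that \<open>k\<close> is odd; so
  reversal occurs for even \<open>k\<close>, here and below.\<close>

lemma bp_list_even:
  "bp_list (2 * Suc k) = map plus_one (bp_list (Suc (2 * k))) @
    map double (if odd k then bp_list (Suc k) else rev (bp_list (Suc k)))"
proof -
  have "(2 * Suc k) mod 4 = 0 \<longleftrightarrow> odd k" by presburger
  then show ?thesis by (subst bp_list.simps) auto
qed

lemma nat_even_odd_cases:
  obtains "n = 0" | k where "n = Suc (2 * k)" | k where "n = 2 * Suc k"
proof (cases "even n")
  case True
  then obtain k where "n = 2 * k" by (elim evenE)
  with that(1,3) show thesis by (cases k) auto
qed (use that(2) in \<open>auto elim!: oddE\<close>)

text \<open>The recursion always puts \<open>plus_one\<close> of the preceding list first, so the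
  head only collects ones.\<close>

lemma hd_bp_list: "hd (bp_list n) = replicate_mset n 1"
proof (induction n rule: less_induct)
  case (less n)
  show ?case
  proof (cases n rule: nat_even_odd_cases)
    case (2 k)
    then show ?thesis
      using less[of "2 * k"] by (simp add: bp_list_odd hd_map bp_list_nonempty plus_one_def)
  next
    case (3 k)
    then show ?thesis
      using less[of "Suc (2 * k)"]
      by (simp only: 3 bp_list_even) (simp add: hd_append hd_map bp_list_nonempty plus_one_def)
  qed simp
qed

lemma double_replicate: "double (replicate_mset q x) = replicate_mset q (2 * x)"
  by (simp add: double_def)

text \<open>For even \<open>k\<close> the reversal moves the doubled head, all twos, to the
  end.\<close>

lemma last_bp_list_double:
  "last (bp_list (2 * Suc k)) =
    (if odd k then double (last (bp_list (Suc k))) else replicate_mset (Suc k) 2)"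
  unfolding bp_list_even using double_replicate[of "Suc k" 1]
  by (simp add: last_map bp_list_nonempty last_rev hd_bp_list del: replicate_mset_Suc)

text \<open>For \<open>n = q * 2 ^ i\<close> with \<open>q\<close> odd, the recursion of
  \<open>last_bp_list_double\<close> halves down to an odd number of twos. Of \<open>q\<close> only
  the oddness is needed for the signs.\<close>

lemma last_bp_list_even:
  "even n \<Longrightarrow> last (bp_list n) = {#} \<or>
    (\<exists>q i. odd q \<and> i \<ge> 1 \<and> last (bp_list n) = replicate_mset q (2 ^ i))"
proof (induction n rule: less_induct)
  case (less n)
  show ?case
  proof (cases n rule: nat_even_odd_cases)
    case (3 k)
    show ?thesis
    proof (cases "odd k")
      case True
      with less.IH[of "Suc k"] consider "last (bp_list (Suc k)) = {#}"
        | q i where "odd q" "i \<ge> 1" "last (bp_list (Suc k)) = replicate_mset q (2 ^ i)"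
        using 3 by auto
      then show ?thesis
      proof cases
        case 1
        then show ?thesis using True by (simp only: 3 last_bp_list_double) (simp add: double_def)
      next
        case (2 q i)
        then have "last (bp_list n) = replicate_mset q (2 ^ Suc i)"
          using True by (simp only: 3 last_bp_list_double) (simp add: double_replicate)
        then show ?thesis using 2(1) by (metis le_add1 plus_1_eq_Suc)
      qed
    next
      case False
      then have "last (bp_list n) = replicate_mset (Suc k) (2 ^ 1)"
        by (simp only: 3 last_bp_list_double) simp
      then show ?thesis using False by (metis even_Suc order_refl)
    qed
  qed (use less.prems in auto)
qed

text \<open>For odd \<open>k\<close> the boundary lies between \<open>k\<close> and
  \<open>Suc k\<close> twos. For even \<open>k\<close> the reversed block starts with the double of
  the last entry of \<open>bp_list (Suc k)\<close>, which exceeds the preceding term by a single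
  2.\<close>

lemma adjacent_boundary:
  "adjacent (strip (last (bp_list (Suc (2 * k)))))
    (double (if odd k then hd (bp_list (Suc k)) else last (bp_list (Suc k))))"
proof (cases "odd k")
  case True
  then obtain l where k: "k = Suc (2 * l)" by (auto elim!: oddE)
  have "last (bp_list (2 * k)) = replicate_mset k 2"
    unfolding k last_bp_list_double by simp
  then have "strip (last (bp_list (Suc (2 * k)))) = replicate_mset k 2"
    by (simp add: bp_list_odd last_map bp_list_nonempty) (simp add: strip_def filter_mset_eq_conv)
  then show ?thesis
    using True adjacent_all_twos[OF True] by (simp add: hd_bp_list double_replicate del: replicate_mset_Suc)
next
  case False
  then have "even k" by simp
  then obtain l where l: "k = 2 * l" by (elim evenE)
  have "last (bp_list (Suc k)) = plus_one (last (bp_list k))"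
    unfolding l by (simp add: bp_list_odd last_map bp_list_nonempty)
  then have successor: "double (last (bp_list (Suc k))) = add_mset 2 (double (last (bp_list k)))"
    by (simp add: plus_one_def double_def)
  \<comment> \<open>For \<open>k = 0\<close> both sides are empty; otherwise \<open>k - 1\<close> is
    odd and no reversal takes place.\<close>
  have "last (bp_list (2 * k)) = double (last (bp_list k))"
    using last_bp_list_double[of "k - 1"] \<open>even k\<close> by (cases k) (auto simp: double_def)
  then have prev: "strip (last (bp_list (Suc (2 * k)))) = double (last (bp_list k))"
    by (simp add: bp_list_odd last_map bp_list_nonempty)
  from last_bp_list_even[OF \<open>even k\<close>] show ?thesis
  proof (elim disjE exE conjE)
    assume "last (bp_list k) = {#}"
    then show ?thesis
      using False adjacent_empty unfolding prev by (simp add: successor) (simp add: double_def)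
  next
    fix q i :: nat assume "odd q" "i \<ge> 1" "last (bp_list k) = replicate_mset q (2 ^ i)"
    then show ?thesis
      using False adjacent_add_2[of q "Suc i"] unfolding prev by (simp add: successor double_replicate)
  qed
qed

text \<open>Stripping turns the \<open>plus_one\<close> part into the earlier list, so only the
  junction and the doubled block at the end are new.\<close>

lemma successively_bp_list: "successively adjacent (map strip (bp_list n))"
proof (induction n rule: less_induct)
  case (less n)
  show ?case
  proof (cases n rule: nat_even_odd_cases)
    case 1
    then show ?thesis by simp
  next
    case (2 k)
    then show ?thesis using less[of "2 * k"] by (simp add: bp_list_odd o_def)
  next
    case (3 k)
    let ?L = "map double (if odd k then bp_list (Suc k) else rev (bp_list (Suc k)))"
    have part: "binary_partition (Suc k) X" if "X \<in> set (bp_list (Suc k))" for X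
      using that by (simp add: set_bp_list)
    have IH: "successively (\<lambda>X Y. adjacent (strip X) (strip Y)) (bp_list (Suc k))"
      using less[of "Suc k"] 3 by (simp add: successively_map)
    \<comment> \<open>For even \<open>k\<close> the doubled neighbours are adjacent in the opposite
      order, and \<open>rev\<close> in \<open>?L\<close> corrects this.\<close>
    have "successively (\<lambda>X Y. if odd k then adjacent (double X) (double Y)
        else adjacent (double Y) (double X)) (bp_list (Suc k))"
      by (rule successively_mono[OF IH]) (use part adjacent_double[of "Suc k"] in auto)
    then have "successively adjacent ?L"
      by (auto simp: successively_map successively_rev)
    moreover have "map strip (bp_list n) = map strip (bp_list (Suc (2 * k))) @ ?L"
      unfolding 3 bp_list_even by (simp add: o_def)
    moreover have "successively adjacent (map strip (bp_list (Suc (2 * k))))"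
      using less[of "Suc (2 * k)"] 3 by simp
    moreover have "adjacent (last (map strip (bp_list (Suc (2 * k))))) (hd ?L)"
      using adjacent_boundary[of k]
      by (auto simp: last_map hd_map hd_rev bp_list_nonempty)
    ultimately show ?thesis
      by (simp add: successively_append_iff)
  qed
qed

section \<open>Blocks of even partitions and the infinite sequence\<close>

lemma even_block_Suc:
  "even_block (2 * Suc k) = map double (if odd k then bp_list (Suc k) else rev (bp_list (Suc k)))"
proof -
  have "filter (\<lambda>P. 1 \<notin># P) (map plus_one xs) = []" for xs
    by (simp add: filter_map o_def plus_one_def)
  moreover have "filter (\<lambda>P. 1 \<notin># P) (map double xs) = map double xs" for xs
    by (rule filter_True) (auto simp: double_def)
  ultimately show ?thesis
    unfolding even_block_def bp_list_even by simp
qed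

text \<open>Since \<open>plus_one\<close> vanishes under stripping, passing from
  \<open>2 * m\<close> to \<open>2 * Suc m\<close> appends exactly one block.\<close>

lemma map_strip_bp_list:
  "map strip (bp_list (2 * m)) = concat (map (\<lambda>k. even_block (2 * k)) [0..<Suc m])"
proof (induction m)
  case 0
  show ?case by (simp add: even_block_def strip_def)
next
  case (Suc m)
  have "map strip (bp_list (2 * Suc m)) = map strip (bp_list (2 * m)) @ even_block (2 * Suc m)"
    unfolding bp_list_even even_block_Suc bp_list_odd by (simp add: o_def)
  then show ?case by (simp only: Suc.IH) simp
qed

lemma flat_smap_fromN:
  assumes "\<And>k. f k \<noteq> []"
  shows "flat (smap f (fromN k)) = concat (map f [k..<k + m]) @- flat (smap f (fromN (k + m)))"
proof (induction m)
  case (Suc m)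
  have "flat (smap f (fromN (k + m))) = f (k + m) @- flat (smap f (fromN (Suc (k + m))))"
    using assms[of "k + m"] by (subst flat_unfold) simp_all
  then show ?case using Suc by simp
qed simp

lemma length_concat_ge:
  assumes "\<And>k. f k \<noteq> []"
  shows "length (concat (map f [0..<m])) \<ge> m"
proof (induction m)
  case (Suc m)
  then show ?case using assms[of m] by (cases "f m") auto
qed simp

text \<open>The blocks for 0 up to \<open>m\<close> are nonempty, so they supply more than
  \<open>n\<close> terms. Any \<open>m\<close> from \<open>n\<close> on is allowed, so that two
  consecutive terms can be read off the same list.\<close>

lemma even_bps_eq_nth:
  assumes "n \<le> m"
  shows "n < length (bp_list (2 * m))" "even_bps !! n = map strip (bp_list (2 * m)) ! n"
proof -
  let ?f = "\<lambda>k. even_block (2 * k)"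
  have len: "n < length (map strip (bp_list (2 * m)))"
    using length_concat_ge[of ?f "Suc m"] assms even_block_nonempty unfolding map_strip_bp_list
    by auto
  then show "n < length (bp_list (2 * m))" by simp
  have "even_bps = map strip (bp_list (2 * m)) @- flat (smap ?f (fromN (Suc m)))"
    unfolding even_bps_def map_strip_bp_list
    using flat_smap_fromN[of ?f 0 "Suc m"] even_block_nonempty by simp
  then show "even_bps !! n = map strip (bp_list (2 * m)) ! n"
    using shift_snth_less[OF len] by metis
qed

lemma adjacent_even_bps: "adjacent (even_bps !! n) (even_bps !! Suc n)"
  using successively_bp_list[of "2 * Suc n"] even_bps_eq_nth[of n "Suc n"]
    even_bps_eq_nth[of "Suc n" "Suc n"]
  by (simp add: successively_conv_nth del: mult_Suc_right)

theorem theorem2: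
  fixes P :: "nat multiset" and n :: nat and d :: "nat \<Rightarrow> nat"
  assumes "P = even_bps !! n"
    and "digits_of P d"
  shows "((\<exists>!u. applicable 1 d u) \<and>
         (\<forall>u. applicable 1 d u \<longrightarrow> partition_of (transform u d) = even_bps !! (n + 1))) \<and>
         (P \<noteq> even_bps !! 0 \<longrightarrow>
         (\<exists>!u. applicable (-1) d u) \<and>
         (\<forall>u. applicable (-1) d u \<longrightarrow> partition_of (transform u d) = even_bps !! (n - 1)))"
proof -
  \<comment> \<open>\<open>step\<close> yields one applicable operation with the right result; by
    uniqueness every applicable operation is that one.\<close>
  have step_unique: "(\<exists>!u. applicable \<sigma> d u) \<and>
      (\<forall>u. applicable \<sigma> d u \<longrightarrow> partition_of (transform u d) = Q)"
    if step: "step \<sigma> P Q" and \<sigma>: "\<sigma> = 1 \<or> \<sigma> = - 1" for \<sigma> Q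
  proof -
    obtain v where "applicable \<sigma> d v" "partition_of (transform v d) = Q"
      using step assms(2) unfolding step_def by blast
    with applicable_unique[OF \<sigma>, of d] show ?thesis by metis
  qed
  have "step 1 P (even_bps !! (n + 1))"
    using adjacent_even_bps[of n] assms(1) by (simp add: adjacent_def)
  \<comment> \<open>The hypothesis excludes \<open>n = 0\<close>, so \<open>n - 1\<close> is a
    genuine predecessor index.\<close>
  moreover have "step (- 1) P (even_bps !! (n - 1))" if "P \<noteq> even_bps !! 0"
    using adjacent_even_bps[of "n - 1"] assms(1) that by (cases n) (auto simp: adjacent_def)
  ultimately show ?thesis
    using step_unique by blast
qed

end
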